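(* Let $p>q>1$ and let $(X,\mu)$ be a doubling metric measure space. Suppose there is a constant $0<C<\infty$ such that $\mu(B_r)\le C r^{p}$ for every ball $B_r\subset X$ of radius $r$. Let $\mathcal{E}$ be a collection of subsets of $X$ such that every $E\in\mathcal{E}$ has conformal dimension at least $1$. Suppose there is a system of measures $\mathbf{E}=\{\lambda_E\}_{E\in\mathcal{E}}$ associated to $\mathcal{E}$ such that $\operatorname{mod}_q(\mathbf{E})>0$ and such that for every $s>1$ there are constants $C_1=C_1(s)>0$ and $C_2=C_2(s)>0$ such that for all $E\in\mathcal{E}$ and all balls $B_r\subset X$ of radius $0<r<\operatorname{diam}X$, $$\lambda_E(B_r\cap E)\ge C_1 r^{s}\quad\text{provided}\quad \tfrac{1}{C_2}B_r\cap E\neq\emptyset.$$ Then the conformal dimension of $X$ is at least $q$.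
   Context: Balls are open metric balls with given center and radius; for $c>0$ and $B=B(x,r)$, $cB=B(x,cr)$. A metric measure space $(X,\mu)$ is doubling if there is a constant $C$ such that $\mu(B(x,2r))\le C\mu(B(x,r))$ for every ball. A system of measures associated to $\mathcal{E}$ assigns to each $E\in\mathcal{E}$ a measure $\lambda_E$ carried by $E$ (i.e. $\lambda_E(X\setminus E)=0$) whose domain contains the domain of $\mu$. For a collection $\mathbf{E}$ of measures on $X$ whose domains contain the domain of $\mu$, a nonnegative measurable function $\rho$ on $X$ is admissible for $\mathbf{E}$ if $\int\rho\,d\lambda\ge1$ for every $\lambda\in\mathbf{E}$. The $q$-modulus (in the sense of Fuglede) is $\operatorname{mod}_q(\mathbf{E})=\inf\int_X\rho^q\,d\mu$, the infimum being over all $\mathbf{E}$-admissible functions $\rho$. Given a homeomorphism $\eta:[0,\infty)\to[0,\infty)$, an embedding $f$ (a homeomorphism onto its image) from a metric space $(X,d_X)$ into a metric space $(Y,d_Y)$ is $\eta$-quasisymmetric if for all distinct triples $x,y,z\in X$ and all $t>0$, $\frac{d_X(x,y)}{d_X(y,z)}\le t$ implies $\frac{d_Y(f(x),f(y))}{d_Y(f(y),f(z))}\le \eta(t)$; it is quasisymmetric if this holds for some $\eta$. The conformal dimension of a metric space is the infimum of the Hausdorff dimensions of its images under quasisymmetric maps into arbitrary metric spaces. *)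

theory Defs
  imports "HOL-Analysis.Analysis"
begin

section \<open>Hausdorff dimension and conformal dimension\<close>

text \<open>Extended-valued, unlike the library's \<open>diameter\<close>, which is unspecified on unbounded sets.
  The empty set has diameter 0.\<close>

definition ediam :: "('a \<Rightarrow> 'a \<Rightarrow> real) \<Rightarrow> 'a set \<Rightarrow> ennreal" where
  "ediam d A = (SUP x\<in>A. SUP y\<in>A. ennreal (d x y))"

text \<open>Only used for exponents \<open>s > 0\<close>.\<close>

definition ennpowr :: "ennreal \<Rightarrow> real \<Rightarrow> ennreal" where
  "ennpowr x s = (if x = \<infinity> then \<infinity> else ennreal (enn2real x powr s))"

definition hausdorff_measure :: "'a set \<Rightarrow> ('a \<Rightarrow> 'a \<Rightarrow> real) \<Rightarrow> real \<Rightarrow> ennreal" where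
  "hausdorff_measure M d s =
     (SUP \<delta>\<in>{0::real<..}.
        Inf {(\<Sum>i. ennpowr (ediam d (U i)) s) | U :: nat \<Rightarrow> 'a set.
              M \<subseteq> (\<Union>i. U i) \<and> (\<forall>i. U i \<subseteq> M \<and> ediam d (U i) \<le> ennreal \<delta>)})"

text \<open>Leaving out \<open>s = 0\<close> does not change the infimum, and avoids the convention for
  \<open>0 powr 0\<close>.\<close>

definition hausdorff_dim :: "'a set \<Rightarrow> ('a \<Rightarrow> 'a \<Rightarrow> real) \<Rightarrow> ennreal" where
  "hausdorff_dim M d = Inf {ennreal s | s :: real. 0 < s \<and> hausdorff_measure M d s = 0}"

definition quasisymmetric ::
  "'a set \<Rightarrow> ('a \<Rightarrow> 'a \<Rightarrow> real) \<Rightarrow> 'b set \<Rightarrow> ('b \<Rightarrow> 'b \<Rightarrow> real) \<Rightarrow> ('a \<Rightarrow> 'b) \<Rightarrow> bool" where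
  "quasisymmetric M d N e f \<longleftrightarrow>
     embedding_map (Metric_space.mtopology M d) (Metric_space.mtopology N e) f \<and>
     (\<exists>\<eta> \<theta>. homeomorphism {0..} {0..} \<eta> \<theta> \<and>
        (\<forall>x\<in>M. \<forall>y\<in>M. \<forall>z\<in>M. \<forall>t>0. x \<noteq> y \<longrightarrow> y \<noteq> z \<longrightarrow> x \<noteq> z \<longrightarrow>
           d x y / d y z \<le> t \<longrightarrow> e (f x) (f y) / e (f y) (f z) \<le> \<eta> t))"

text \<open>The infimum over arbitrary metric target spaces. A definition cannot range over all types, so
  the targets have points in the type of the source. No generality is lost: the image carries, up to
  isometry, a metric on the source itself. The lemma \<open>conformal_dim_le\<close> below states that the bound
  holds for targets over every type.\<close>

definition conformal_dim :: "'a set \<Rightarrow> ('a \<Rightarrow> 'a \<Rightarrow> real) \<Rightarrow> ennreal" where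
  "conformal_dim M d =
     Inf {hausdorff_dim (f ` M) e | (f :: 'a \<Rightarrow> 'a) N e.
            Metric_space N e \<and> quasisymmetric M d N e f}"

lemma hausdorff_dim_pullback_le:
  fixes f :: "'a \<Rightarrow> 'b"
  shows "hausdorff_dim M (\<lambda>x y. e (f x) (f y)) \<le> hausdorff_dim (f ` M) e"
proof -
  let ?d = "\<lambda>x y. e (f x) (f y)"
  let ?S = "\<lambda>s \<delta>. {(\<Sum>i. ennpowr (ediam ?d (U i)) s) | U :: nat \<Rightarrow> 'a set.
              M \<subseteq> (\<Union>i. U i) \<and> (\<forall>i. U i \<subseteq> M \<and> ediam ?d (U i) \<le> ennreal \<delta>)}"
  let ?T = "\<lambda>s \<delta>. {(\<Sum>i. ennpowr (ediam e (U i)) s) | U :: nat \<Rightarrow> 'b set.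
              f ` M \<subseteq> (\<Union>i. U i) \<and> (\<forall>i. U i \<subseteq> f ` M \<and> ediam e (U i) \<le> ennreal \<delta>)}"
  have sub: "?T s \<delta> \<subseteq> ?S s \<delta>" for s \<delta>
  proof
    fix v
    assume "v \<in> ?T s \<delta>"
    then obtain U :: "nat \<Rightarrow> 'b set" where v: "v = (\<Sum>i. ennpowr (ediam e (U i)) s)"
      and U: "f ` M \<subseteq> (\<Union>i. U i)" "\<forall>i. U i \<subseteq> f ` M \<and> ediam e (U i) \<le> ennreal \<delta>"
      by blast
    define V where "V = (\<lambda>i. M \<inter> f -` U i)"
    have fV: "f ` V i = U i" for i
      using U(2) by (fastforce simp: V_def)
    have diam: "ediam ?d (V i) = ediam e (U i)" for i
      unfolding ediam_def fV[symmetric] image_image ..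
    have cov: "M \<subseteq> (\<Union>i. V i)"
      using U(1) unfolding V_def by blast
    have sm: "\<forall>i. V i \<subseteq> M \<and> ediam ?d (V i) \<le> ennreal \<delta>"
      unfolding diam using U(2) by (simp add: V_def)
    have "v = (\<Sum>i. ennpowr (ediam ?d (V i)) s)"
      unfolding diam by (rule v)
    with cov sm show "v \<in> ?S s \<delta>"
      by (intro CollectI exI[of _ V] conjI)
  qed
  have le: "hausdorff_measure M ?d s \<le> hausdorff_measure (f ` M) e s" for s
    unfolding hausdorff_measure_def
    by (rule SUP_subset_mono[OF subset_refl]) (rule Inf_superset_mono[OF sub])
  have "hausdorff_measure M ?d s = 0" if "hausdorff_measure (f ` M) e s = 0" for s
    using le[of s] that by simp
  then show ?thesis
    unfolding hausdorff_dim_def by (intro Inf_superset_mono) blast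
qed

lemma conformal_dim_le:
  fixes f :: "'a \<Rightarrow> 'b"
  assumes M: "Metric_space M d" and N: "Metric_space N e" and f: "quasisymmetric M d N e f"
  shows "conformal_dim M d \<le> hausdorff_dim (f ` M) e"
proof -
  define d' where "d' = (\<lambda>x y. e (f x) (f y))"
  interpret M: Metric_space M d by fact
  interpret N: Metric_space N e by fact
  have emb: "embedding_map M.mtopology N.mtopology f"
    using f by (simp add: quasisymmetric_def)
  then have hom: "homeomorphic_map M.mtopology (subtopology N.mtopology (f ` M)) f"
    by (simp add: embedding_map_def)
  have inj: "inj_on f M"
    using homeomorphic_imp_injective_map[OF hom] by simp
  have "f ` M = N \<inter> f ` M"
    using homeomorphic_imp_surjective_map[OF hom] by (metis M.topspace_mtopology N.topspace_mtopology topspace_subtopology)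
  then have fN: "f ` M \<subseteq> N"
    by blast
  have M': "Metric_space M d'"
    using inj fN unfolding d'_def
    by unfold_locales (auto simp: N.commute inj_on_def image_subset_iff intro: N.triangle)
  interpret P: Metric_space12 M d' N e
    using M' N by (simp add: Metric_space12_def)
  have "embedding_map P.M1.mtopology N.mtopology f"
    by (rule P.isometry_imp_embedding_map) (use fN in \<open>auto simp: d'_def\<close>)
  then have hom': "homeomorphic_map P.M1.mtopology (subtopology N.mtopology (f ` M)) f"
    by (simp add: embedding_map_def)
  obtain g where g: "homeomorphic_maps P.M1.mtopology (subtopology N.mtopology (f ` M)) f g"
    using hom' homeomorphic_map_maps by blast
  then have "homeomorphic_map (subtopology N.mtopology (f ` M)) P.M1.mtopology g"
    by (simp add: homeomorphic_maps_map)
  with hom have "homeomorphic_map M.mtopology P.M1.mtopology (g \<circ> f)"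
    by (rule homeomorphic_map_compose)
  then have "homeomorphic_map M.mtopology P.M1.mtopology id"
    by (rule homeomorphic_map_eq) (use g in \<open>auto simp: homeomorphic_maps_def\<close>)
  then have "embedding_map M.mtopology P.M1.mtopology id"
    by (simp add: embedding_map_def)
  then have "quasisymmetric M d M d' id"
    using f unfolding quasisymmetric_def by (simp add: d'_def)
  then have "conformal_dim M d \<le> hausdorff_dim (id ` M) d'"
    unfolding conformal_dim_def using M' by (intro Inf_lower) blast
  also have "\<dots> \<le> hausdorff_dim (f ` M) e"
    using hausdorff_dim_pullback_le[of M e f] by (simp add: d'_def)
  finally show ?thesis .
qed

section \<open>Metric measure spaces and modulus\<close>

text \<open>The measure is defined at least on the Borel sets; its domain may be larger
  (e.g. completed).\<close>

definition metric_measure_space :: "'a::metric_space measure \<Rightarrow> bool" where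
  "metric_measure_space \<mu> \<longleftrightarrow> space \<mu> = UNIV \<and> sets borel \<subseteq> sets \<mu>"

definition doubling :: "'a::metric_space measure \<Rightarrow> bool" where
  "doubling \<mu> \<longleftrightarrow>
     (\<exists>C::real. \<forall>x. \<forall>r>0. emeasure \<mu> (ball x (2 * r)) \<le> ennreal C * emeasure \<mu> (ball x r))"

definition system_of_measures :: "'a measure \<Rightarrow> 'a set set \<Rightarrow> ('a set \<Rightarrow> 'a measure) \<Rightarrow> bool" where
  "system_of_measures \<mu> \<E> \<nu> \<longleftrightarrow>
     (\<forall>E\<in>\<E>. space (\<nu> E) = space \<mu> \<and> sets \<mu> \<subseteq> sets (\<nu> E) \<and> space \<mu> - E \<in> null_sets (\<nu> E))"

text \<open>Admissible functions may take the value \<open>\<infinity>\<close>.\<close>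

definition admissible :: "'a measure \<Rightarrow> 'a measure set \<Rightarrow> ('a \<Rightarrow> ennreal) \<Rightarrow> bool" where
  "admissible \<mu> \<Lambda> \<rho> \<longleftrightarrow> \<rho> \<in> borel_measurable \<mu> \<and> (\<forall>l\<in>\<Lambda>. 1 \<le> (\<integral>\<^sup>+ x. \<rho> x \<partial>l))"

definition modulus :: "real \<Rightarrow> 'a measure \<Rightarrow> 'a measure set \<Rightarrow> ennreal" where
  "modulus q \<mu> \<Lambda> = Inf {(\<integral>\<^sup>+ x. ennpowr (\<rho> x) q \<partial>\<mu>) | \<rho>. admissible \<mu> \<Lambda> \<rho>}"

end

theory Submission
  imports Defs
begin

text \<open>Suppose that some quasisymmetric image of \<open>X\<close> had Hausdorff dimension less than \<open>q\<close>. Pull its metric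
  back to a metric \<open>d\<close> on \<open>X\<close>. For some \<open>t < q\<close> there are arbitrarily fine covers \<open>V\<^sub>i\<close> of \<open>X\<close> with
  \<open>\<Sum>\<^sub>i D\<^sub>i\<^sup>t\<close> as small as desired, where \<open>D\<^sub>i\<close> is the \<open>d\<close>-diameter of \<open>V\<^sub>i\<close>. If the cover is fine enough, each \<open>V\<^sub>i\<close> with
  \<open>D\<^sub>i > 0\<close> lies well inside a ball \<open>B\<^sub>i\<close> of the original metric, of radius \<open>r\<^sub>i\<close>, whose \<open>d\<close>-diameter is still
  comparable to \<open>D\<^sub>i\<close>, by quasisymmetry (\<open>ball_around_small_set\<close>). Consider
  \<open>\<rho> = (\<Sum>\<^sub>i D\<^sub>i\<^sup>t / r\<^sub>i\<^sup>p \<cdot> 1\<^bsub>B\<^sub>i\<^esub>)\<close> to the power \<open>1 / q\<close>.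

  Upper bound (\<open>nn_integral_ball_sum_le\<close>): as \<open>\<mu>(B\<^sub>i) \<le> C r\<^sub>i\<^sup>p\<close>, the integral of \<open>\<rho>\<^sup>q\<close> is at most
  \<open>C \<Sum>\<^sub>i D\<^sub>i\<^sup>t\<close>. Taking the root of a sum, instead of the sum of the roots, makes this computation exact
  and insensitive to overlaps of the balls.

  Lower bound (\<open>nn_integral_density_root_ge\<close>): \<open>\<rho>\<close> is at least \<open>D\<^sub>i\<^sup>a / r\<^sub>i\<^sup>s\<close> on \<open>B\<^sub>i\<close>, with \<open>a = t / q < 1\<close> and
  \<open>s = p / q > 1\<close>. For \<open>E \<in> \<E>\<close> select greedily, by decreasing \<open>D\<^sub>i\<close>, a disjoint family among the balls whose
  \<open>V\<^sub>i\<close> meet \<open>E\<close> (\<open>greedy_disjoint_subfamily\<close>). The mass bound for \<open>\<nu> E\<close> gives \<open>\<integral>\<rho> d(\<nu> E) \<ge> C\<^sub>1 \<Sum> D\<^sub>i\<^sup>a\<close>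
  over the selected balls. Their enlargements in the metric \<open>d\<close> cover \<open>E\<close> up to countably many points, so this
  sum is bounded below by a multiple of the \<open>a\<close>-dimensional Hausdorff content of \<open>E\<close>, which is positive because
  the conformal dimension of \<open>E\<close> is at least \<open>1 > a\<close>.

  The content depends on \<open>E\<close>, so one cover does not suffice. Summing over a sequence of finer and finer covers,
  with weights, yields one integrable function whose root has infinite integral against every \<open>\<nu> E\<close>. Hence
  the modulus is zero (\<open>modulus_eq_0_of_small_dimension\<close>), a contradiction.\<close>

section \<open>Extended nonnegative reals\<close>

lemma ennpowr_ennreal: "0 \<le> x \<Longrightarrow> ennpowr (ennreal x) s = ennreal (x powr s)"
  by (simp add: ennpowr_def)

lemma ennpowr_zero: "ennpowr 0 s = 0"
  by (simp add: ennpowr_def)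

lemma ennpowr_mono:
  assumes "x \<le> y" "0 \<le> s"
  shows "ennpowr x s \<le> ennpowr y s"
proof (cases "y = \<infinity>")
  case False
  then have "enn2real x \<le> enn2real y"
    using assms(1) by (simp add: enn2real_mono less_top)
  moreover have "x \<noteq> \<infinity>"
    using False assms(1) by (auto simp: top_unique)
  ultimately show ?thesis
    using assms(2) by (auto simp: ennpowr_def intro!: ennreal_leI powr_mono2)
qed (simp add: ennpowr_def)

lemma ennpowr_mult_left:
  assumes "0 < c" "0 < s"
  shows "ennpowr (ennreal c * x) s = ennreal (c powr s) * ennpowr x s"
  using assms
  by (cases x) (auto simp: ennpowr_def ennreal_mult_top powr_mult simp flip: ennreal_mult)

lemma ennpowr_ennpowr_inverse:
  assumes "0 < q"
  shows "ennpowr (ennpowr x (1 / q)) q = x"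
  using assms by (cases x) (auto simp: ennpowr_def powr_powr)

lemma measurable_ennpowr [measurable]: "(\<lambda>x. ennpowr x s) \<in> borel_measurable borel"
  unfolding ennpowr_def by measurable

lemma ennreal_term_le_suminf: "f n \<le> (\<Sum>i. f i)" for f :: "nat \<Rightarrow> ennreal"
  using sum_le_suminf[of f "{n}"] by simp

section \<open>Fine covers and Hausdorff dimension\<close>

definition fine_cover :: "'a set \<Rightarrow> ('a \<Rightarrow> 'a \<Rightarrow> real) \<Rightarrow> real \<Rightarrow> (nat \<Rightarrow> 'a set) \<Rightarrow> bool" where
  "fine_cover M d \<delta> U \<longleftrightarrow> M \<subseteq> (\<Union>i. U i) \<and> (\<forall>i. U i \<subseteq> M \<and> ediam d (U i) \<le> ennreal \<delta>)"

lemma hausdorff_measure_fine_cover: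
  "hausdorff_measure M d s =
     (SUP \<delta>\<in>{0<..}. Inf {(\<Sum>i. ennpowr (ediam d (U i)) s) | U. fine_cover M d \<delta> U})"
  by (simp add: hausdorff_measure_def fine_cover_def)

lemma fine_cover_small_sum:
  assumes "hausdorff_measure M d s = 0" "0 < \<delta>" "0 < \<epsilon>"
  obtains U where "fine_cover M d \<delta> U" "(\<Sum>i. ennpowr (ediam d (U i)) s) < ennreal \<epsilon>"
proof -
  have "Inf {(\<Sum>i. ennpowr (ediam d (U i)) s) | U. fine_cover M d \<delta> U} \<le> hausdorff_measure M d s"
    unfolding hausdorff_measure_fine_cover using assms(2) by (intro SUP_upper) auto
  also have "\<dots> < ennreal \<epsilon>"
    using assms by simp
  finally show ?thesis
    using that unfolding Inf_less_iff by blast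
qed

lemma fine_cover_sum_bounded_below:
  assumes "hausdorff_measure M d s \<noteq> 0"
  obtains \<delta> \<kappa> where "0 < \<delta>" "0 < \<kappa>"
    "\<And>U. fine_cover M d \<delta> U \<Longrightarrow> ennreal \<kappa> \<le> (\<Sum>i. ennpowr (ediam d (U i)) s)"
proof -
  let ?h = "\<lambda>\<delta>. Inf {(\<Sum>i. ennpowr (ediam d (U i)) s) | U. fine_cover M d \<delta> U}"
  obtain \<delta> where \<delta>: "0 < \<delta>" "0 < ?h \<delta>"
    using assms unfolding hausdorff_measure_fine_cover
    by (metis (no_types, lifting) SUP_least greaterThan_iff not_gr_zero order_refl zero_le bot_ennreal le_zero_eq)
  then obtain y where y: "0 < y" "y < ?h \<delta>"
    using dense by blast
  then have "y \<noteq> top" by auto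
  then obtain \<kappa> where \<kappa>: "y = ennreal \<kappa>" "0 \<le> \<kappa>"
    by (cases y) auto
  show ?thesis
  proof
    show "0 < \<delta>" by fact
    show "0 < \<kappa>" using y \<kappa> by simp
    fix U
    assume "fine_cover M d \<delta> U"
    then have "?h \<delta> \<le> (\<Sum>i. ennpowr (ediam d (U i)) s)"
      by (intro Inf_lower) blast
    then show "ennreal \<kappa> \<le> (\<Sum>i. ennpowr (ediam d (U i)) s)"
      using y \<kappa> by simp
  qed
qed

lemma ediam_image: "ediam e (f ` A) = ediam (\<lambda>x y. e (f x) (f y)) A"
  by (simp add: ediam_def image_image)

text \<open>Together with \<open>hausdorff_dim_pullback_le\<close>, this allows the target of a quasisymmetric map to be
  replaced by a second metric on the source: a cover of \<open>M\<close> is pushed forward, set by set, with the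
  diameters unchanged.\<close>

lemma hausdorff_dim_image_le:
  "hausdorff_dim (f ` M) e \<le> hausdorff_dim M (\<lambda>x y. e (f x) (f y))"
proof -
  let ?d = "\<lambda>x y. e (f x) (f y)"
  have "hausdorff_measure (f ` M) e s \<le> hausdorff_measure M ?d s" for s
    unfolding hausdorff_measure_fine_cover
  proof (rule SUP_subset_mono[OF subset_refl], rule Inf_superset_mono, rule subsetI)
    fix \<delta> :: real and v
    assume "v \<in> {(\<Sum>i. ennpowr (ediam ?d (U i)) s) |U. fine_cover M ?d \<delta> U}"
    then obtain U where "fine_cover M ?d \<delta> U" "v = (\<Sum>i. ennpowr (ediam ?d (U i)) s)"
      by blast
    then have "fine_cover (f ` M) e \<delta> (\<lambda>i. f ` U i)" "v = (\<Sum>i. ennpowr (ediam e (f ` U i)) s)"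
      by (simp_all add: fine_cover_def ediam_image image_mono flip: image_UN)
    then show "v \<in> {(\<Sum>i. ennpowr (ediam e (U i)) s) |U. fine_cover (f ` M) e \<delta> U}"
      by (intro CollectI exI[of _ "\<lambda>i. f ` U i"] conjI)
  qed
  then have "hausdorff_measure (f ` M) e s = 0" if "hausdorff_measure M ?d s = 0" for s
    using that by (metis le_zero_eq)
  then show ?thesis
    unfolding hausdorff_dim_def by (intro Inf_superset_mono) blast
qed

lemma ediam_upper: "x \<in> A \<Longrightarrow> y \<in> A \<Longrightarrow> ennreal (d x y) \<le> ediam d A"
  unfolding ediam_def by (meson SUP_upper2 order_refl)

lemma ediam_le:
  assumes "\<And>x y. x \<in> A \<Longrightarrow> y \<in> A \<Longrightarrow> d x y \<le> D"
  shows "ediam d A \<le> ennreal D"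
  unfolding ediam_def using assms by (intro SUP_least ennreal_leI)

lemma ediam_mono: "A \<subseteq> B \<Longrightarrow> ediam d A \<le> ediam d B"
  unfolding ediam_def by (intro SUP_subset_mono) auto

section \<open>Quasisymmetric maps\<close>

lemma quasisymmetricE:
  assumes "quasisymmetric M d N e f"
  obtains \<eta> \<theta> where "embedding_map (Metric_space.mtopology M d) (Metric_space.mtopology N e) f"
    and "homeomorphism {0..} {0..} \<eta> \<theta>"
    and "\<And>x y z t. x \<in> M \<Longrightarrow> y \<in> M \<Longrightarrow> z \<in> M \<Longrightarrow> 0 < t \<Longrightarrow> x \<noteq> y \<Longrightarrow> y \<noteq> z \<Longrightarrow> x \<noteq> z \<Longrightarrow>
           d x y / d y z \<le> t \<Longrightarrow> e (f x) (f y) / e (f y) (f z) \<le> \<eta> t"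
  using assms unfolding quasisymmetric_def
  apply (elim conjE exE)
  apply (rule that, assumption, assumption)
  apply simp
  done

lemma quasisymmetric_subset:
  assumes M: "Metric_space M d" and N: "Metric_space N e"
    and f: "quasisymmetric M d N e f" and "E \<subseteq> M"
  shows "quasisymmetric E d N e f"
proof -
  interpret M: Metric_space M d by fact
  interpret S: Submetric M d E by unfold_locales fact
  have "homeomorphic_map M.mtopology (subtopology (Metric_space.mtopology N e) (f ` M)) f"
    using f by (simp add: quasisymmetric_def embedding_map_def)
  moreover from this have "f ` (topspace M.mtopology \<inter> E) =
      topspace (subtopology (Metric_space.mtopology N e) (f ` M)) \<inter> f ` E"
    using \<open>E \<subseteq> M\<close> homeomorphic_imp_surjective_map
    by (metis M.topspace_mtopology image_mono inf.absorb2)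
  ultimately have "homeomorphic_map (subtopology M.mtopology E)
      (subtopology (subtopology (Metric_space.mtopology N e) (f ` M)) (f ` E)) f"
    by (rule homeomorphic_map_subtopologies)
  moreover have "f ` M \<inter> f ` E = f ` E"
    using \<open>E \<subseteq> M\<close> by blast
  ultimately have "homeomorphic_map (subtopology M.mtopology E)
      (subtopology (Metric_space.mtopology N e) (f ` E)) f"
    by (simp add: subtopology_subtopology)
  moreover have "topspace (subtopology M.mtopology E) = E"
    using \<open>E \<subseteq> M\<close> by (simp add: inf.absorb2)
  ultimately have emb: "embedding_map (Metric_space.mtopology E d) (Metric_space.mtopology N e) f"
    unfolding embedding_map_def S.mtopology_submetric by metis
  from f show ?thesis
  proof (rule quasisymmetricE)
    fix \<eta> \<theta> :: "real \<Rightarrow> real"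
    assume "homeomorphism {0..} {0..} \<eta> \<theta>"
      and qs: "\<And>x y z t. x \<in> M \<Longrightarrow> y \<in> M \<Longrightarrow> z \<in> M \<Longrightarrow> 0 < t \<Longrightarrow> x \<noteq> y \<Longrightarrow> y \<noteq> z \<Longrightarrow> x \<noteq> z \<Longrightarrow>
        d x y / d y z \<le> t \<Longrightarrow> e (f x) (f y) / e (f y) (f z) \<le> \<eta> t"
    with emb show ?thesis
      unfolding quasisymmetric_def using \<open>E \<subseteq> M\<close>
      by (intro conjI exI[of _ \<eta>] exI[of _ \<theta>] ballI allI impI) (auto intro!: qs)
  qed
qed

lemma quasisymmetric_inj:
  assumes M: "Metric_space M d" and N: "Metric_space N e" and f: "quasisymmetric M d N e f"
  shows "inj_on f M" and "f ` M \<subseteq> N"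
proof -
  interpret M: Metric_space M d by fact
  interpret N: Metric_space N e by fact
  have hom: "homeomorphic_map M.mtopology (subtopology N.mtopology (f ` M)) f"
    using f by (simp add: quasisymmetric_def embedding_map_def)
  show "inj_on f M"
    using homeomorphic_imp_injective_map[OF hom] by simp
  show "f ` M \<subseteq> N"
  proof -
    have "f ` M = N \<inter> f ` M"
      using homeomorphic_imp_surjective_map[OF hom]
      by (metis M.topspace_mtopology N.topspace_mtopology topspace_subtopology)
    then show ?thesis by blast
  qed
qed

text \<open>The scale \<open>K\<close> is fixed once and for all, so the control function enters only through its value at
  \<open>K\<close>. Passing to the maximum with 1 covers the degenerate triples with \<open>y = x\<close> or \<open>y = v\<close>, about which
  quasisymmetry is silent.\<close>

lemma quasisymmetric_bound:
  fixes f :: "'a::metric_space \<Rightarrow> 'b"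
  assumes N: "Metric_space N e" and f: "quasisymmetric UNIV dist N e f" and "0 < K"
  obtains A where "1 \<le> A"
    "\<And>x v y. x \<noteq> v \<Longrightarrow> dist y x \<le> K * dist x v \<Longrightarrow> e (f y) (f x) \<le> A * e (f x) (f v)"
proof -
  interpret N: Metric_space N e by fact
  have M: "Metric_space (UNIV :: 'a set) dist"
    by unfold_locales (auto simp: dist_commute dist_triangle)
  have inj: "inj f" and ran: "range f \<subseteq> N"
    using quasisymmetric_inj[OF M N f] by auto
  have posd: "0 < e (f x) (f v)" if "x \<noteq> v" for x v
    using that inj ran N.mdist_pos_eq by (metis inj_eq range_subsetD)
  obtain \<eta> where \<eta>: "\<And>x y z t. 0 < t \<Longrightarrow> x \<noteq> y \<Longrightarrow> y \<noteq> z \<Longrightarrow> x \<noteq> z \<Longrightarrow>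
      dist x y / dist y z \<le> t \<Longrightarrow> e (f x) (f y) / e (f y) (f z) \<le> \<eta> t"
    using f by (rule quasisymmetricE) (rule that; simp)
  show ?thesis
  proof
    show "1 \<le> max 1 (\<eta> K)" by simp
    fix x v y :: 'a
    assume xv: "x \<noteq> v" and le: "dist y x \<le> K * dist x v"
    consider "y = x" | "y = v" | "y \<noteq> x" "y \<noteq> v" by blast
    then show "e (f y) (f x) \<le> max 1 (\<eta> K) * e (f x) (f v)"
    proof cases
      case 1
      then have "e (f y) (f x) = 0"
        using ran by (simp add: range_subsetD)
      then show ?thesis by (simp add: zero_le_mult_iff)
    next
      case 2
      have "1 * e (f x) (f v) \<le> max 1 (\<eta> K) * e (f x) (f v)"
        by (intro mult_right_mono) auto
      with 2 show ?thesis by (simp add: N.commute)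
    next
      case 3
      have "dist y x / dist x v \<le> K"
        using xv le by (simp add: field_simps)
      then have "e (f y) (f x) / e (f x) (f v) \<le> \<eta> K"
        using \<eta>[of K y x v] 3 xv \<open>0 < K\<close> by auto
      then have "e (f y) (f x) \<le> \<eta> K * e (f x) (f v)"
        using posd[OF xv] by (simp add: field_simps)
      also have "\<dots> \<le> max 1 (\<eta> K) * e (f x) (f v)"
        by (intro mult_right_mono) auto
      finally show ?thesis .
    qed
  qed
qed

text \<open>The ball is centred in \<open>V\<close> and its radius is \<open>2 * c\<close> times a distance \<open>dist x v\<close> that comes within a
  factor 2 of the supremum of the distances from \<open>x\<close> to points of \<open>V\<close>. The factor 2 puts \<open>V\<close> into the
  shrunken ball, and \<open>qs\<close> with this \<open>x\<close> and \<open>v\<close> applies to every point of the ball, where \<open>d x v \<le> D\<close>.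

  Both the boundedness of \<open>V\<close> and the comparison of the radius with the diameter of the space come from
  \<open>small\<close>: if \<open>2 * c * dist x v\<close> reached the distances from \<open>x\<close> to \<open>a\<close> and to \<open>b\<close>, then \<open>a\<close> and \<open>b\<close> would both
  be within \<open>A * D\<close> of \<open>x\<close> in the metric \<open>d\<close>.\<close>

lemma ball_around_small_set:
  fixes d :: "'a::metric_space \<Rightarrow> 'a \<Rightarrow> real"
  assumes d: "Metric_space UNIV d" and "0 < c" and "0 \<le> A"
    and qs: "\<And>x v y. x \<noteq> v \<Longrightarrow> dist y x \<le> 2 * c * dist x v \<Longrightarrow> d y x \<le> A * d x v"
    and V: "ediam d V = ennreal D" "0 < D" and small: "2 * A * D < d a b"
  obtains x r where "0 < r" "x \<in> V" "V \<subseteq> ball x (r / c)" "ennreal r < ediam dist (UNIV :: 'a set)"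
    "\<And>y. y \<in> ball x r \<Longrightarrow> d y x \<le> A * D"
proof -
  interpret d: Metric_space UNIV d by fact
  have dV: "d x y \<le> D" if "x \<in> V" "y \<in> V" for x y
    using ediam_upper[OF that, of d] V by simp
  have "\<exists>x\<in>V. \<exists>u\<in>V. x \<noteq> u"
  proof (rule ccontr)
    assume "\<not> ?thesis"
    then have "d x y \<le> 0" if "x \<in> V" "y \<in> V" for x y
      using that by force
    then have "ediam d V \<le> ennreal 0"
      by (rule ediam_le)
    with V show False by simp
  qed
  then obtain x u where x: "x \<in> V" and u: "u \<in> V" "x \<noteq> u" by blast
  have far: "2 * c * dist x v < max (dist a x) (dist b x)" if v: "v \<in> V" "v \<noteq> x" for v
  proof (rule ccontr)
    assume "\<not> ?thesis"
    then have "dist a x \<le> 2 * c * dist x v" "dist b x \<le> 2 * c * dist x v"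
      by auto
    then have "d a x \<le> A * d x v" "d b x \<le> A * d x v"
      using qs v by auto
    moreover have "A * d x v \<le> A * D"
      using dV x v \<open>0 \<le> A\<close> by (intro mult_left_mono) auto
    moreover have "d a b \<le> d a x + d b x"
      using d.triangle[of a x b] d.commute[of x b] by simp
    ultimately show False using small by simp
  qed
  define s where "s = (SUP w\<in>V. dist x w)"
  have "dist x w \<le> max (dist a x) (dist b x) / (2 * c)" if "w \<in> V" for w
    using far[OF that] \<open>0 < c\<close> by (cases "w = x") (auto simp: field_simps le_max_iff_disj)
  then have bdd: "bdd_above (dist x ` V)"
    by (intro bdd_aboveI2)
  have le_s: "dist x w \<le> s" if "w \<in> V" for w
    unfolding s_def using that bdd by (rule cSUP_upper)
  have "0 < s"
    using le_s[OF u(1)] u(2) by (smt (verit) zero_less_dist_iff)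
  then obtain v where v: "v \<in> V" "s / 2 < dist x v"
    using less_cSUP_iff[of V "dist x" "s / 2"] bdd x unfolding s_def by auto
  with \<open>0 < s\<close> have "v \<noteq> x" by auto
  show ?thesis
  proof
    show "0 < 2 * c * dist x v"
      using \<open>0 < c\<close> \<open>v \<noteq> x\<close> by simp
    show "x \<in> V" by fact
    show "V \<subseteq> ball x (2 * c * dist x v / c)"
    proof
      fix w
      assume "w \<in> V"
      then have "dist x w < 2 * dist x v"
        using le_s v by (smt (verit) field_sum_of_halves)
      then show "w \<in> ball x (2 * c * dist x v / c)"
        using \<open>0 < c\<close> by simp
    qed
    have "2 * c * dist x v < max (dist a x) (dist b x)"
      using far v \<open>v \<noteq> x\<close> by blast
    then have "ennreal (2 * c * dist x v) < ennreal (max (dist a x) (dist b x))"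
      by (intro ennreal_lessI le_less_trans[OF _ \<open>2 * c * dist x v < max (dist a x) (dist b x)\<close>])
        (use \<open>0 < c\<close> in auto)
    also have "\<dots> \<le> ediam dist (UNIV :: 'a set)"
      by (simp add: max_def ediam_upper)
    finally show "ennreal (2 * c * dist x v) < ediam dist (UNIV :: 'a set)" .
    fix y
    assume "y \<in> ball x (2 * c * dist x v)"
    then have "dist y x \<le> 2 * c * dist x v"
      by (simp add: dist_commute)
    then have "d y x \<le> A * d x v"
      using qs[of x v y] \<open>v \<noteq> x\<close> by auto
    also have "\<dots> \<le> A * D"
      using dV x v \<open>0 \<le> A\<close> by (intro mult_left_mono) auto
    finally show "d y x \<le> A * D" .
  qed
qed

section \<open>Selection of disjoint sets\<close>

text \<open>Vitali selection, ordered by the weights \<open>D\<close> and not by radii. Below, \<open>B i\<close> is a ball in the source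
  and \<open>D i\<close> controls the diameter of its image; the radii may be unbounded, but the weights tend to 0.
  Hence the order \<open>R\<close> by decreasing weight, with ties broken by the index, has finite initial segments.
  The set \<open>J\<close> is defined by recursion along it: an index is accepted iff its set is disjoint from all
  sets accepted before.\<close>

lemma greedy_disjoint_subfamily:
  fixes D :: "nat \<Rightarrow> real" and B :: "nat \<Rightarrow> 'b set"
  assumes fin: "\<And>c. 0 < c \<Longrightarrow> finite {i. c \<le> D i}"
    and pos: "\<And>i. i \<in> S \<Longrightarrow> 0 < D i" and ne: "\<And>i. i \<in> S \<Longrightarrow> B i \<noteq> {}"
  obtains J where "J \<subseteq> S" "disjoint_family_on B J"
    "\<And>i. i \<in> S \<Longrightarrow> \<exists>j\<in>J. D i \<le> D j \<and> B i \<inter> B j \<noteq> {}"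
proof -
  define R where "R = {(j, i). i \<in> S \<and> (D i < D j \<or> D i = D j \<and> j < i)}"
  have "finite {j. (j, i) \<in> R}" for i
  proof (cases "i \<in> S")
    case True
    have "{j. (j, i) \<in> R} \<subseteq> {j. D i \<le> D j}"
      by (auto simp: R_def)
    then show ?thesis
      using fin[OF pos[OF True]] finite_subset by blast
  qed (simp add: R_def)
  moreover have "irrefl R" "trans R"
    by (auto simp: R_def irrefl_def trans_def)
  ultimately have wf: "wf R"
    by (intro wf_finite_segments)
  define J where "J = {i. wfrec R (\<lambda>g i. i \<in> S \<and> (\<forall>j. (j, i) \<in> R \<longrightarrow> g j \<longrightarrow> B j \<inter> B i = {})) i}"
  have J: "i \<in> J \<longleftrightarrow> i \<in> S \<and> (\<forall>j\<in>J. (j, i) \<in> R \<longrightarrow> B j \<inter> B i = {})" for i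
    unfolding J_def mem_Collect_eq by (subst wfrec[OF wf]) (auto simp: cut_apply)
  show ?thesis
  proof
    show "J \<subseteq> S"
      using J by blast
    show "disjoint_family_on B J"
      unfolding disjoint_family_on_def
    proof (intro ballI impI)
      fix i j
      assume ij: "i \<in> J" "j \<in> J" "i \<noteq> j"
      then have "(i, j) \<in> R \<or> (j, i) \<in> R"
        using J[of i] J[of j] by (simp add: R_def) linarith
      then show "B i \<inter> B j = {}"
        using ij J[of i] J[of j] by (metis Int_commute)
    qed
    fix i
    assume i: "i \<in> S"
    show "\<exists>j\<in>J. D i \<le> D j \<and> B i \<inter> B j \<noteq> {}"
    proof (cases "i \<in> J")
      case True
      then show ?thesis using ne[OF i] by auto
    next
      case False
      then obtain j where "j \<in> J" "(j, i) \<in> R" "B j \<inter> B i \<noteq> {}"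
        using J i by blast
      then have "D i \<le> D j" "B i \<inter> B j \<noteq> {}"
        by (auto simp: R_def)
      with \<open>j \<in> J\<close> show ?thesis by blast
    qed
  qed
qed

lemma finite_large_terms:
  assumes "(\<Sum>i. ennreal (D i powr t)) < \<infinity>" "0 < t" "0 < c"
  shows "finite {i :: nat. c \<le> D i}"
proof -
  have "summable (\<lambda>i. D i powr t)"
    using assms(1) by (intro summable_suminf_not_top) (auto simp: less_top)
  then have "(\<lambda>i. D i powr t) \<longlonglongrightarrow> 0"
    by (rule summable_LIMSEQ_zero)
  then have "\<forall>\<^sub>F i in sequentially. D i powr t < c powr t"
    using \<open>0 < c\<close> by (intro order_tendstoD) auto
  then have "\<forall>\<^sub>F i in cofinite. \<not> c \<le> D i"
    unfolding cofinite_eq_sequentially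
    by eventually_elim (smt (verit) \<open>0 < t\<close> \<open>0 < c\<close> powr_mono2)
  then show ?thesis
    by (simp add: eventually_cofinite)
qed

section \<open>The density attached to a cover\<close>

text \<open>The exponent \<open>p\<close> of the radii is the one in the growth condition, so each ball contributes
  \<open>C * D i powr t\<close> and the balls may overlap arbitrarily.\<close>

lemma nn_integral_ball_sum_le:
  fixes \<mu> :: "'a::metric_space measure" and D :: "nat \<Rightarrow> real"
  assumes \<mu>: "sets borel \<subseteq> sets \<mu>"
    and growth: "\<And>x r. 0 < r \<Longrightarrow> emeasure \<mu> (ball x r) \<le> ennreal (C * r powr p)"
    and "0 \<le> C" and r: "\<And>i. D i \<noteq> 0 \<Longrightarrow> 0 < r i"
  shows "(\<integral>\<^sup>+z. (\<Sum>i. ennreal (D i powr t / r i powr p) * indicator (ball (x i) (r i)) z) \<partial>\<mu>)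
           \<le> ennreal C * (\<Sum>i. ennreal (D i powr t))"
proof -
  have [measurable]: "ball y s \<in> sets \<mu>" for y s
    using \<mu> borel_open by blast
  have "(\<integral>\<^sup>+z. (\<Sum>i. ennreal (D i powr t / r i powr p) * indicator (ball (x i) (r i)) z) \<partial>\<mu>)
      = (\<Sum>i. ennreal (D i powr t / r i powr p) * emeasure \<mu> (ball (x i) (r i)))"
    by (subst nn_integral_suminf) (auto simp: nn_integral_cmult_indicator)
  also have "\<dots> \<le> (\<Sum>i. ennreal C * ennreal (D i powr t))"
  proof (intro suminf_le summableI)
    fix i
    show "ennreal (D i powr t / r i powr p) * emeasure \<mu> (ball (x i) (r i)) \<le> ennreal C * ennreal (D i powr t)"
    proof (cases "D i = 0")
      case False
      have "ennreal (D i powr t / r i powr p) * emeasure \<mu> (ball (x i) (r i))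
          \<le> ennreal (D i powr t / r i powr p) * ennreal (C * r i powr p)"
        using growth r[OF False] by (intro mult_left_mono) auto
      also have "\<dots> = ennreal C * ennreal (D i powr t)"
        using r[OF False] \<open>0 \<le> C\<close> by (simp flip: ennreal_mult)
      finally show ?thesis .
    qed simp
  qed
  finally show ?thesis by simp
qed

text \<open>Let \<open>a = t / q\<close>. On the ball with index \<open>i\<close> the integrand is at least \<open>D i powr a / r i powr (p / q)\<close>,
  so, by the mass bound, each member of a disjoint family of balls contributes at least
  \<open>C\<^sub>1 * D i powr a\<close> if its concentric ball of radius \<open>r i / c\<close> meets \<open>E\<close>. For the greedy family \<open>J\<close>, the
  sum of \<open>D i powr a\<close> is bounded below by the Hausdorff content of \<open>E\<close> with respect to \<open>d\<close>: whenever
  \<open>D i > 0\<close> and \<open>V i\<close> meets \<open>E\<close>, there is \<open>j \<in> J\<close> with \<open>D i \<le> D j\<close> whose ball meets the ball of \<open>i\<close>, and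
  then the triangle inequality in \<open>d\<close> puts \<open>V i\<close> within \<open>(2 * A + 1) * D j\<close> of \<open>x j\<close>.\<close>

lemma nn_integral_density_root_ge:
  fixes l :: "'a::metric_space measure" and D r :: "nat \<Rightarrow> real" and x :: "nat \<Rightarrow> 'a"
  assumes d: "Metric_space UNIV d" and "0 < q" "0 < t" "0 \<le> A" "0 \<le> C\<^sub>1"
    and sets: "sets borel \<subseteq> sets l" and space: "space l = UNIV"
    and cover: "(\<Union>i. V i) = UNIV"
    and D: "\<And>i. ediam d (V i) = ennreal (D i)" "\<And>i. 0 \<le> D i"
    and sum: "(\<Sum>i. ennreal (D i powr t)) < \<infinity>"
    and ball: "\<And>i. 0 < D i \<Longrightarrow> 0 < r i \<and> x i \<in> V i \<and> V i \<subseteq> ball (x i) (r i / c)"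
    and image: "\<And>i y. 0 < D i \<Longrightarrow> y \<in> ball (x i) (r i) \<Longrightarrow> d y (x i) \<le> A * D i"
    and mass: "\<And>i. 0 < D i \<Longrightarrow> ball (x i) (r i / c) \<inter> E \<noteq> {} \<Longrightarrow>
                 ennreal (C\<^sub>1 * r i powr (p / q)) \<le> emeasure l (ball (x i) (r i))"
    and content: "\<And>U. fine_cover E d \<delta> U \<Longrightarrow> ennreal \<kappa> \<le> (\<Sum>i. ennpowr (ediam d (U i)) (t / q))"
    and fine: "\<And>i. (4 * A + 2) * D i \<le> \<delta>" and "0 < \<kappa>"
  shows "ennreal (C\<^sub>1 * \<kappa> / (4 * A + 2) powr (t / q))
    \<le> (\<integral>\<^sup>+z. ennpowr (\<Sum>i. ennreal (D i powr t / r i powr p) * indicator (ball (x i) (r i)) z) (1 / q) \<partial>l)"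
proof -
  interpret d: Metric_space UNIV d by fact
  define B where "B = (\<lambda>i. ball (x i) (r i))"
  define a where "a = t / q"
  define S where "S = {i. 0 < D i \<and> V i \<inter> E \<noteq> {}}"
  define L where "L = 4 * A + 2"
  have "0 < L" "0 < a"
    using \<open>0 \<le> A\<close> \<open>0 < t\<close> \<open>0 < q\<close> by (auto simp: L_def a_def)
  have [measurable]: "B i \<in> sets l" for i
    using sets borel_open unfolding B_def by blast
  have ne: "B i \<noteq> {}" if "i \<in> S" for i
    using that ball unfolding S_def B_def by fastforce
  obtain J where J: "J \<subseteq> S" "disjoint_family_on B J"
    and greedy: "\<And>i. i \<in> S \<Longrightarrow> \<exists>j\<in>J. D i \<le> D j \<and> B i \<inter> B j \<noteq> {}"
    by (rule greedy_disjoint_subfamily[of D S B])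
      (use finite_large_terms[OF sum \<open>0 < t\<close>] ne in \<open>auto simp: S_def\<close>)
  have J_pos: "0 < D i" "0 < r i" "V i \<inter> E \<noteq> {}" if "i \<in> J" for i
    using that J ball by (auto simp: S_def)

  \<comment> \<open>Indices with \<open>D i = 0\<close> have no ball. Their sets are kept in the cover, at no cost in the
    content sum because \<open>0 powr a = 0\<close>.\<close>
  define W where "W = (\<lambda>i. if i \<in> J then {u \<in> E. d u (x i) \<le> (2 * A + 1) * D i}
    else if D i = 0 then V i \<inter> E else {})"
  have diam_W: "ediam d (W i) \<le> ennreal (if i \<in> J then L * D i else 0)" for i
  proof (cases "i \<in> J")
    case True
    have "d u v \<le> L * D i" if "u \<in> W i" "v \<in> W i" for u v
    proof -
      have "d u (x i) \<le> (2 * A + 1) * D i" "d v (x i) \<le> (2 * A + 1) * D i"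
        using that True by (auto simp: W_def)
      moreover have "d u v \<le> d u (x i) + d v (x i)"
        using d.triangle[of u "x i" v] d.commute[of "x i" v] by simp
      ultimately show ?thesis
        by (simp add: L_def algebra_simps)
    qed
    with True show ?thesis
      using ediam_le[of "W i" d "L * D i"] by simp
  next
    case False
    show ?thesis
    proof (cases "D i = 0")
      case True
      have "ediam d (W i) \<le> ediam d (V i)"
        using True False by (intro ediam_mono) (auto simp: W_def)
      also have "\<dots> = 0"
        using D(1)[of i] True by simp
      finally show ?thesis by simp
    next
      case False': False
      with False show ?thesis by (simp add: W_def ediam_def bot_ennreal)
    qed
  qed
  have cover_W: "u \<in> (\<Union>i. W i)" if "u \<in> E" for u
  proof -
    obtain i where i: "u \<in> V i"
      using cover by blast
    show ?thesis
    proof (cases "D i = 0 \<and> i \<notin> J")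
      case True
      then have "u \<in> W i"
        using i that by (simp add: W_def)
      then show ?thesis by blast
    next
      case False
      then have pos: "0 < D i"
        using D(2)[of i] J_pos by (auto simp: less_le)
      then have "i \<in> S"
        using i that by (auto simp: S_def)
      then obtain j y where j: "j \<in> J" "D i \<le> D j" and y: "y \<in> B i" "y \<in> B j"
        using greedy by blast
      have "ennreal (d u (x i)) \<le> ennreal (D i)"
        unfolding D(1)[symmetric] using i ball[OF pos] by (intro ediam_upper) auto
      then have "d u (x i) \<le> D j"
        using pos j(2) by simp
      moreover have "d y (x i) \<le> A * D j"
        using image[OF pos] y(1) mult_left_mono[OF j(2) \<open>0 \<le> A\<close>] by (force simp: B_def)
      moreover have "d y (x j) \<le> A * D j"
        using image J_pos(1)[OF j(1)] y(2) by (simp add: B_def)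
      moreover have "d u (x j) \<le> d u (x i) + d y (x i) + d y (x j)"
        using d.triangle[of u "x i" "x j"] d.triangle[of "x i" y "x j"] d.commute[of "x i" y] by simp
      ultimately have "d u (x j) \<le> (2 * A + 1) * D j"
        by (simp add: algebra_simps)
      then have "u \<in> W j"
        using j(1) that by (simp add: W_def)
      then show ?thesis by blast
    qed
  qed
  have "fine_cover E d \<delta> W"
    unfolding fine_cover_def
  proof (intro conjI allI)
    show "E \<subseteq> (\<Union>i. W i)"
      using cover_W by blast
    show "W i \<subseteq> E" for i
      by (auto simp: W_def)
    fix i
    have "0 \<le> L * D i"
      using D(2)[of i] \<open>0 < L\<close> by simp
    then have "(if i \<in> J then L * D i else 0) \<le> \<delta>"
      using fine[of i] by (simp add: L_def)
    then show "ediam d (W i) \<le> ennreal \<delta>"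
      using diam_W[of i] ennreal_leI order_trans by blast
  qed
  then have "ennreal \<kappa> \<le> (\<Sum>i. ennpowr (ediam d (W i)) a)"
    unfolding a_def by (rule content)
  also have "\<dots> \<le> (\<Sum>i. ennreal (L powr a) * (if i \<in> J then ennreal (D i powr a) else 0))"
  proof (intro suminf_le summableI)
    fix i
    have "ennpowr (ediam d (W i)) a \<le> ennpowr (ennreal (if i \<in> J then L * D i else 0)) a"
      using \<open>0 < a\<close> by (intro ennpowr_mono diam_W) auto
    also have "\<dots> = ennreal (L powr a) * (if i \<in> J then ennreal (D i powr a) else 0)"
      using D(2)[of i] \<open>0 < L\<close> by (simp add: ennpowr_def powr_mult ennreal_mult)
    finally show "ennpowr (ediam d (W i)) a \<le> \<dots>" .
  qed
  finally have content_J: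
    "ennreal \<kappa> \<le> ennreal (L powr a) * (\<Sum>i. if i \<in> J then ennreal (D i powr a) else 0)"
    by simp

  let ?g = "\<lambda>z. \<Sum>i. ennreal (D i powr t / r i powr p) * indicator (B i) z"
  define w where "w = (\<lambda>i. if i \<in> J then ennreal (D i powr a / r i powr (p / q)) else 0)"
  have root: "w i * indicator (B i) z \<le> ennpowr (?g z) (1 / q)" for i z
  proof (cases "i \<in> J \<and> z \<in> B i")
    case True
    then have "0 < r i" using J_pos by blast
    have "ennreal (D i powr t / r i powr p) * indicator (B i) z \<le> ?g z"
      by (rule ennreal_term_le_suminf)
    then have "ennpowr (ennreal (D i powr t / r i powr p)) (1 / q) \<le> ennpowr (?g z) (1 / q)"
      using True \<open>0 < q\<close> by (intro ennpowr_mono) auto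
    also have "ennpowr (ennreal (D i powr t / r i powr p)) (1 / q) = w i"
      using True \<open>0 < r i\<close> by (simp add: ennpowr_ennreal w_def powr_divide powr_powr a_def)
    finally show ?thesis using True by simp
  qed (auto simp: w_def)
  have "ennreal (C\<^sub>1 * \<kappa> / L powr a) = ennreal (C\<^sub>1 / L powr a) * ennreal \<kappa>"
    using \<open>0 \<le> C\<^sub>1\<close> \<open>0 < \<kappa>\<close> by (simp flip: ennreal_mult)
  also have "\<dots> \<le> ennreal (C\<^sub>1 / L powr a) *
      (ennreal (L powr a) * (\<Sum>i. if i \<in> J then ennreal (D i powr a) else 0))"
    by (intro mult_left_mono content_J) auto
  also have "\<dots> = ennreal C\<^sub>1 * (\<Sum>i. if i \<in> J then ennreal (D i powr a) else 0)"
    using \<open>0 \<le> C\<^sub>1\<close> \<open>0 < L\<close> by (simp add: mult.assoc[symmetric] flip: ennreal_mult)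
  also have "\<dots> = (\<Sum>i. ennreal C\<^sub>1 * (if i \<in> J then ennreal (D i powr a) else 0))"
    by simp
  also have "\<dots> \<le> (\<Sum>i. w i * emeasure l (B i))"
  proof (intro suminf_le summableI)
    fix i
    show "ennreal C\<^sub>1 * (if i \<in> J then ennreal (D i powr a) else 0) \<le> w i * emeasure l (B i)"
    proof (cases "i \<in> J")
      case True
      have "V i \<subseteq> ball (x i) (r i / c)"
        using ball J_pos(1)[OF True] by blast
      then have "ennreal (C\<^sub>1 * r i powr (p / q)) \<le> emeasure l (B i)"
        using J_pos(1,3)[OF True] unfolding B_def by (intro mass) auto
      then have "w i * ennreal (C\<^sub>1 * r i powr (p / q)) \<le> w i * emeasure l (B i)"
        by (intro mult_left_mono) auto
      moreover have "w i * ennreal (C\<^sub>1 * r i powr (p / q)) = ennreal C\<^sub>1 * ennreal (D i powr a)"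
        using True J_pos(2)[OF True] \<open>0 \<le> C\<^sub>1\<close> by (simp add: w_def flip: ennreal_mult)
      ultimately show ?thesis using True by simp
    qed simp
  qed
  also have "\<dots> = (\<integral>\<^sup>+z. (\<Sum>i. w i * indicator (B i) z) \<partial>l)"
    by (subst nn_integral_suminf) (auto simp: nn_integral_cmult_indicator)
  also have "\<dots> \<le> (\<integral>\<^sup>+z. ennpowr (?g z) (1 / q) \<partial>l)"
  proof (rule nn_integral_mono)
    fix z
    show "(\<Sum>i. w i * indicator (B i) z) \<le> ennpowr (?g z) (1 / q)"
    proof (cases "\<exists>j\<in>J. z \<in> B j")
      case True
      then obtain j where j: "j \<in> J" "z \<in> B j" by blast
      have "w i * indicator (B i) z = 0" if "i \<noteq> j" for i
        using that j J(2) by (auto simp: w_def disjoint_family_on_def indicator_def)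
      then have "(\<Sum>i. w i * indicator (B i) z) = (\<Sum>i\<in>{j}. w i * indicator (B i) z)"
        by (intro suminf_finite) auto
      also have "\<dots> = w j * indicator (B j) z"
        by (simp only: sum.insert finite.emptyI empty_iff not_False_eq_True sum.empty add_0_right)
      finally show ?thesis
        using root[of j z] by simp
    next
      case False
      then have "w i * indicator (B i) z = 0" for i
        by (auto simp: w_def indicator_def)
      then show ?thesis
        by (simp only: suminf_zero zero_le)
    qed
  qed
  finally show ?thesis
    by (simp add: L_def a_def B_def)
qed

section \<open>Vanishing of the modulus\<close>

text \<open>If \<open>G\<close> is integrable while the \<open>q\<close>-th root of every positive multiple of \<open>G\<close> is admissible, the modulus
  is at most \<open>k\<close> times the integral of \<open>G\<close> for every \<open>k > 0\<close>.\<close>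

lemma modulus_eq_0I:
  assumes "0 < q" and G: "G \<in> borel_measurable \<mu>" "(\<integral>\<^sup>+z. G z \<partial>\<mu>) < \<infinity>"
    and adm: "\<And>l k. l \<in> \<Lambda> \<Longrightarrow> 0 < k \<Longrightarrow> 1 \<le> (\<integral>\<^sup>+z. ennpowr (ennreal k * G z) (1 / q) \<partial>l)"
  shows "modulus q \<mu> \<Lambda> = 0"
proof -
  obtain I where I: "(\<integral>\<^sup>+z. G z \<partial>\<mu>) = ennreal I" "0 \<le> I"
    using G(2) by (cases "\<integral>\<^sup>+z. G z \<partial>\<mu>") auto
  have "modulus q \<mu> \<Lambda> \<le> ennreal \<epsilon>" if "0 < \<epsilon>" for \<epsilon>
  proof -
    define k where "k = \<epsilon> / (I + 1)"
    have "0 < k"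
      using that I by (simp add: k_def)
    have "admissible \<mu> \<Lambda> (\<lambda>z. ennpowr (ennreal k * G z) (1 / q))"
      unfolding admissible_def using adm \<open>0 < k\<close> G(1)
      by (auto intro!: measurable_compose[OF _ measurable_ennpowr])
    then have "modulus q \<mu> \<Lambda> \<le> (\<integral>\<^sup>+z. ennpowr (ennpowr (ennreal k * G z) (1 / q)) q \<partial>\<mu>)"
      unfolding modulus_def
      by (intro Inf_lower CollectI exI[of _ "\<lambda>z. ennpowr (ennreal k * G z) (1 / q)"] conjI refl)
    also have "\<dots> = ennreal k * ennreal I"
      using G(1) I(1) \<open>0 < q\<close> by (simp add: ennpowr_ennpowr_inverse nn_integral_cmult)
    also have "\<dots> = ennreal (k * I)"
      using \<open>0 < k\<close> I by (simp add: ennreal_mult)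
    also have "\<dots> \<le> ennreal \<epsilon>"
      using that I by (intro ennreal_leI) (simp add: k_def field_simps)
    finally show ?thesis .
  qed
  then have "modulus q \<mu> \<Lambda> \<le> 0"
    using ennreal_le_epsilon[of 0 "modulus q \<mu> \<Lambda>"] by simp
  then show ?thesis by simp
qed

text \<open>The metric \<open>d\<close> plays the role of a quasisymmetric image of the space. Covers at scales \<open>\<delta> n\<close> tending to 0
  give densities \<open>g n\<close> with integral at most \<open>C * (1/4) ^ n\<close>, whereas the lower bound for the integral of the root
  of \<open>g n\<close> against a measure of the system depends on the set \<open>E\<close> but, once \<open>\<delta> n\<close> is small enough for \<open>E\<close>,
  not on \<open>n\<close>. The weights \<open>2 ^ n\<close> in \<open>G\<close> grow without bound and still leave \<open>G\<close> integrable; this is how one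
  function serves all of \<open>\<E>\<close> although the constants are not uniform over \<open>\<E>\<close>.\<close>

lemma modulus_eq_0_of_small_dimension:
  fixes \<mu> :: "'a::metric_space measure" and d :: "'a \<Rightarrow> 'a \<Rightarrow> real"
  assumes "0 < q" "0 \<le> C"
    and \<mu>: "metric_measure_space \<mu>"
    and growth: "\<And>x r. 0 < r \<Longrightarrow> emeasure \<mu> (ball x r) \<le> ennreal (C * r powr p)"
    and \<nu>: "system_of_measures \<mu> \<E> \<nu>"
    and "0 < C\<^sub>1" "0 < C\<^sub>2"
    and mass: "\<And>E x r. E \<in> \<E> \<Longrightarrow> 0 < r \<Longrightarrow> ennreal r < ediam dist (UNIV :: 'a set) \<Longrightarrow>
                 ball x (r / C\<^sub>2) \<inter> E \<noteq> {} \<Longrightarrow>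
                 ennreal (C\<^sub>1 * r powr (p / q)) \<le> emeasure (\<nu> E) (ball x r)"
    and d: "Metric_space UNIV d" and "0 \<le> A"
    and qs: "\<And>x v y. x \<noteq> v \<Longrightarrow> dist y x \<le> 2 * C\<^sub>2 * dist x v \<Longrightarrow> d y x \<le> A * d x v"
    and dim_E: "\<And>E. E \<in> \<E> \<Longrightarrow> 1 \<le> hausdorff_dim E d"
    and dim: "hausdorff_dim UNIV d < ennreal q"
  shows "modulus q \<mu> (\<nu> ` \<E>) = 0"
proof (cases "\<E> = {}")
  case True
  then show ?thesis
    using \<open>0 < q\<close> by (intro modulus_eq_0I[where G = "\<lambda>_. 0"]) auto
next
  case False
  then obtain E\<^sub>0 where "E\<^sub>0 \<in> \<E>" by blast
  interpret d: Metric_space UNIV d by fact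
  have sets_\<mu>: "sets borel \<subseteq> sets \<mu>" and space_\<mu>: "space \<mu> = UNIV"
    using \<mu> by (auto simp: metric_measure_space_def)
  obtain t where t: "0 < t" "t < q" "hausdorff_measure UNIV d t = 0"
    using dim \<open>0 < q\<close> unfolding hausdorff_dim_def Inf_less_iff by (auto simp: ennreal_less_iff)
  have content: "hausdorff_measure E d (t / q) \<noteq> 0" if "E \<in> \<E>" for E
  proof
    assume "hausdorff_measure E d (t / q) = 0"
    then have "hausdorff_dim E d \<le> ennreal (t / q)"
      unfolding hausdorff_dim_def using t(1) \<open>0 < q\<close> by (intro Inf_lower) auto
    also have "\<dots> < 1"
      using t by (simp add: ennreal_less_one_iff)
    finally show False
      using dim_E[OF that] by simp
  qed
  have "\<exists>a b. 0 < d a b"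
  proof (rule ccontr)
    assume "\<not> ?thesis"
    then have "d x y \<le> 0" for x y
      using not_less by blast
    then have "ediam d E\<^sub>0 \<le> ennreal 0"
      by (intro ediam_le)
    then have "ediam d E\<^sub>0 = 0" by simp
    then have cover: "fine_cover E\<^sub>0 d \<delta> (\<lambda>_. E\<^sub>0)"
      and sum: "(\<Sum>i::nat. ennpowr (ediam d E\<^sub>0) (t / q)) = 0" for \<delta>
      by (auto simp: fine_cover_def ennpowr_zero)
    obtain \<delta> \<kappa> where "0 < \<kappa>"
      and "\<And>U. fine_cover E\<^sub>0 d \<delta> U \<Longrightarrow> ennreal \<kappa> \<le> (\<Sum>i. ennpowr (ediam d (U i)) (t / q))"
      using fine_cover_sum_bounded_below[OF content[OF \<open>E\<^sub>0 \<in> \<E>\<close>]] by blast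
    from this(1) this(2)[OF cover] show False
      unfolding sum by simp
  qed
  then obtain a b where ab: "0 < d a b" by blast

  \<comment> \<open>The factor in front makes \<open>2 * A * \<delta> n < d a b\<close>, as the choice of the balls requires.\<close>
  define \<delta> where "\<delta> = (\<lambda>n. d a b / (2 * A + 1) / real (Suc n))"
  have \<delta>_pos: "0 < \<delta> n" for n
    using ab \<open>0 \<le> A\<close> by (simp add: \<delta>_def)
  have \<delta>_small: "2 * A * \<delta> n < d a b" for n
  proof -
    have "2 * A * \<delta> n \<le> 2 * A * (d a b / (2 * A + 1))"
      using ab \<open>0 \<le> A\<close> unfolding \<delta>_def by (intro mult_left_mono divide_left_mono[where b = 1, simplified]) auto
    also have "\<dots> < d a b"
      using ab \<open>0 \<le> A\<close> by (simp add: field_simps)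
    finally show ?thesis .
  qed
  have \<delta>_lim: "\<delta> \<longlonglongrightarrow> 0"
    unfolding \<delta>_def by (rule LIMSEQ_Suc[OF lim_const_over_n])
  have "\<exists>U. fine_cover UNIV d (\<delta> n) U \<and> (\<Sum>i. ennpowr (ediam d (U i)) t) < ennreal ((1/4) ^ n)" for n
    by (rule fine_cover_small_sum[OF t(3) \<delta>_pos[of n], of "(1/4) ^ n"]) auto
  then obtain V where V: "\<And>n. fine_cover UNIV d (\<delta> n) (V n)"
    and V_sum: "\<And>n. (\<Sum>i. ennpowr (ediam d (V n i)) t) < ennreal ((1/4) ^ n)"
    by metis
  define D where "D = (\<lambda>n i. enn2real (ediam d (V n i)))"
  have D_nonneg: "0 \<le> D n i" for n i
    by (simp add: D_def)
  have V_le: "ediam d (V n i) \<le> ennreal (\<delta> n)" for n i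
    using V by (simp add: fine_cover_def)
  then have D: "ediam d (V n i) = ennreal (D n i)" for n i
    unfolding D_def using le_less_trans[OF V_le ennreal_less_top] by (simp add: ennreal_enn2real)
  have D_le: "D n i \<le> \<delta> n" for n i
    using V_le[of n i] \<delta>_pos[of n] unfolding D by simp
  have D_sum: "(\<Sum>i. ennreal (D n i powr t)) < ennreal ((1/4) ^ n)" for n
    using V_sum[of n] by (simp add: D ennpowr_ennreal D_nonneg)

  define adapted where "adapted = (\<lambda>n i x r. 0 < r \<and> x \<in> V n i \<and> V n i \<subseteq> ball x (r / C\<^sub>2) \<and>
      ennreal r < ediam dist (UNIV :: 'a set) \<and> (\<forall>y\<in>ball x r. d y x \<le> A * D n i))"
  have "\<exists>x r. 0 < D n i \<longrightarrow> adapted n i x r" for n i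
  proof (cases "0 < D n i")
    case True
    have "2 * A * D n i < d a b"
      using D_le[of n i] \<delta>_small[of n] \<open>0 \<le> A\<close> mult_left_mono[of "D n i" "\<delta> n" "2 * A"] by simp
    from ball_around_small_set[OF d \<open>0 < C\<^sub>2\<close> \<open>0 \<le> A\<close> qs D True this]
    show ?thesis unfolding adapted_def by metis
  qed simp
  then obtain X R where XR: "\<And>n i. 0 < D n i \<Longrightarrow> adapted n i (X n i) (R n i)"
    by metis
  have R_pos: "D n i \<noteq> 0 \<Longrightarrow> 0 < R n i" for n i
    using XR[of n i] D_nonneg[of n i] by (auto simp: adapted_def less_le)

  define g where "g = (\<lambda>n z. \<Sum>i. ennreal (D n i powr t / R n i powr p) * indicator (ball (X n i) (R n i)) z)"
  define G where "G = (\<lambda>z. \<Sum>n. ennreal (2 ^ n) * g n z)"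
  have g_meas: "g n \<in> borel_measurable borel" for n
    unfolding g_def
    by (intro borel_measurable_suminf_order borel_measurable_times_ennreal borel_measurable_const
        borel_measurable_indicator borel_open open_ball)
  have G_meas: "G \<in> borel_measurable borel"
    unfolding G_def
    by (intro borel_measurable_suminf_order borel_measurable_times_ennreal borel_measurable_const g_meas)
  have to_\<mu>: "f \<in> borel_measurable \<mu>" if "f \<in> borel_measurable borel" for f :: "'a \<Rightarrow> ennreal"
    using that sets_\<mu> space_\<mu> by (auto simp: measurable_def)
  have g_int: "(\<integral>\<^sup>+z. g n z \<partial>\<mu>) \<le> ennreal C * ennreal ((1/4) ^ n)" for n
  proof -
    have "(\<integral>\<^sup>+z. g n z \<partial>\<mu>) \<le> ennreal C * (\<Sum>i. ennreal (D n i powr t))"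
      unfolding g_def by (rule nn_integral_ball_sum_le[OF sets_\<mu> growth \<open>0 \<le> C\<close> R_pos])
    also have "\<dots> \<le> ennreal C * ennreal ((1/4) ^ n)"
      using D_sum[of n] by (intro mult_left_mono) auto
    finally show ?thesis .
  qed
  have "(\<integral>\<^sup>+z. G z \<partial>\<mu>) = (\<Sum>n. ennreal (2 ^ n) * (\<integral>\<^sup>+z. g n z \<partial>\<mu>))"
    unfolding G_def using to_\<mu>[OF g_meas] by (simp add: nn_integral_suminf nn_integral_cmult)
  also have "\<dots> \<le> (\<Sum>n. ennreal C * ennreal ((1/2) ^ n))"
  proof (intro suminf_le summableI)
    fix n
    have "ennreal (2 ^ n) * (\<integral>\<^sup>+z. g n z \<partial>\<mu>) \<le> ennreal (2 ^ n) * (ennreal C * ennreal ((1/4) ^ n))"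
      by (intro mult_left_mono g_int) auto
    also have "\<dots> = ennreal C * ennreal (2 ^ n * (1/4) ^ n)"
      by (simp add: ennreal_mult mult.left_commute)
    also have "(2::real) ^ n * (1/4) ^ n = (1/2) ^ n"
      by (simp flip: power_mult_distrib)
    finally show "ennreal (2 ^ n) * (\<integral>\<^sup>+z. g n z \<partial>\<mu>) \<le> ennreal C * ennreal ((1/2) ^ n)" .
  qed
  also have "\<dots> = ennreal C * ennreal (\<Sum>n. (1/2) ^ n)"
    by (simp add: suminf_ennreal2)
  also have "\<dots> < \<infinity>"
    by (simp add: ennreal_mult_less_top)
  finally have G_int: "(\<integral>\<^sup>+z. G z \<partial>\<mu>) < \<infinity>" .

  show ?thesis
  proof (rule modulus_eq_0I[OF \<open>0 < q\<close> to_\<mu>[OF G_meas] G_int])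
    fix l and k :: real
    assume "l \<in> \<nu> ` \<E>" and "0 < k"
    then obtain E where E: "E \<in> \<E>" and l: "l = \<nu> E" by blast
    have sets_l: "sets borel \<subseteq> sets l" and space_l: "space l = UNIV"
      using \<nu> E l sets_\<mu> space_\<mu> by (auto simp: system_of_measures_def)
    obtain \<delta>\<^sub>0 \<kappa> where \<kappa>: "0 < \<delta>\<^sub>0" "0 < \<kappa>"
      "\<And>U. fine_cover E d \<delta>\<^sub>0 U \<Longrightarrow> ennreal \<kappa> \<le> (\<Sum>i. ennpowr (ediam d (U i)) (t / q))"
      using fine_cover_sum_bounded_below[OF content[OF E]] by blast
    define m where "m = C\<^sub>1 * \<kappa> / (4 * A + 2) powr (t / q)"
    have "0 < m"
      using \<kappa> \<open>0 < C\<^sub>1\<close> \<open>0 \<le> A\<close> by (simp add: m_def)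
    have "\<forall>\<^sub>F n in sequentially. \<delta> n < \<delta>\<^sub>0 / (4 * A + 2)"
      using \<kappa>(1) \<open>0 \<le> A\<close> by (intro order_tendstoD[OF \<delta>_lim]) auto
    moreover have "\<forall>\<^sub>F n in sequentially. (1 / m) powr q / k \<le> 2 ^ n"
      using filterlim_realpow_sequentially_gt1[of "2::real"]
      by (auto simp: filterlim_at_infinity_conv_norm_at_top filterlim_at_top)
    ultimately obtain n where n: "\<delta> n < \<delta>\<^sub>0 / (4 * A + 2)" "(1 / m) powr q / k \<le> 2 ^ n"
      using eventually_happens'[OF sequentially_bot eventually_conj] by blast
    have fine: "(4 * A + 2) * D n i \<le> \<delta>\<^sub>0" for i
    proof -
      have "(4 * A + 2) * D n i \<le> (4 * A + 2) * \<delta> n"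
        using D_le \<open>0 \<le> A\<close> by (intro mult_left_mono) auto
      also have "\<dots> \<le> \<delta>\<^sub>0"
        using n(1) \<open>0 \<le> A\<close> by (simp add: field_simps)
      finally show ?thesis .
    qed
    have "ennreal m \<le> (\<integral>\<^sup>+z. ennpowr (g n z) (1 / q) \<partial>l)"
      unfolding m_def g_def
    proof (rule nn_integral_density_root_ge[where c = C\<^sub>2, OF d \<open>0 < q\<close> t(1) \<open>0 \<le> A\<close> _ sets_l space_l])
      show "(\<Union>i. V n i) = UNIV"
        using V[of n] by (auto simp: fine_cover_def)
      show "(\<Sum>i. ennreal (D n i powr t)) < \<infinity>"
        using D_sum[of n] ennreal_less_top less_trans by (metis infinity_ennreal_def)
      fix i
      assume pos: "0 < D n i"
      show "0 < R n i \<and> X n i \<in> V n i \<and> V n i \<subseteq> ball (X n i) (R n i / C\<^sub>2)"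
        using XR[OF pos] by (simp add: adapted_def)
      show "d y (X n i) \<le> A * D n i" if "y \<in> ball (X n i) (R n i)" for y
        using XR[OF pos] that by (simp add: adapted_def)
      assume "ball (X n i) (R n i / C\<^sub>2) \<inter> E \<noteq> {}"
      then show "ennreal (C\<^sub>1 * R n i powr (p / q)) \<le> emeasure l (ball (X n i) (R n i))"
        using XR[OF pos] mass[OF E] unfolding l adapted_def by blast
    qed (use \<kappa> D D_nonneg fine \<open>0 < C\<^sub>1\<close> in auto)
    moreover have "1 \<le> (k * 2 ^ n) powr (1 / q) * m"
    proof -
      have "(1 / m) powr q \<le> k * 2 ^ n"
        using n(2) \<open>0 < k\<close> by (simp add: field_simps)
      then have "((1 / m) powr q) powr (1 / q) \<le> (k * 2 ^ n) powr (1 / q)"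
        using \<open>0 < q\<close> by (intro powr_mono2) auto
      then show ?thesis
        using \<open>0 < q\<close> \<open>0 < m\<close> by (simp add: powr_powr field_simps)
    qed
    ultimately have "1 \<le> ennreal ((k * 2 ^ n) powr (1 / q)) * (\<integral>\<^sup>+z. ennpowr (g n z) (1 / q) \<partial>l)"
      using \<open>0 < m\<close>
      by (smt (verit) ennreal_1 ennreal_leI ennreal_mult mult_left_mono order_trans powr_ge_zero zero_le)
    also have "\<dots> = (\<integral>\<^sup>+z. ennpowr (ennreal (k * 2 ^ n) * g n z) (1 / q) \<partial>l)"
    proof -
      have "g n \<in> borel_measurable l"
        using g_meas sets_l space_l by (auto simp: measurable_def)
      then have "(\<lambda>z. ennpowr (g n z) (1 / q)) \<in> borel_measurable l"
        by (rule measurable_compose[OF _ measurable_ennpowr])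
      moreover have "ennpowr (ennreal (k * 2 ^ n) * g n z) (1 / q)
          = ennreal ((k * 2 ^ n) powr (1 / q)) * ennpowr (g n z) (1 / q)" for z
        using \<open>0 < k\<close> \<open>0 < q\<close> by (intro ennpowr_mult_left) auto
      ultimately show ?thesis
        by (simp add: nn_integral_cmult)
    qed
    also have "\<dots> \<le> (\<integral>\<^sup>+z. ennpowr (ennreal k * G z) (1 / q) \<partial>l)"
    proof (intro nn_integral_mono ennpowr_mono)
      fix z
      have "ennreal (2 ^ n) * g n z \<le> G z"
        unfolding G_def by (rule ennreal_term_le_suminf)
      then have "ennreal k * (ennreal (2 ^ n) * g n z) \<le> ennreal k * G z"
        by (rule mult_left_mono) simp
      then show "ennreal (k * 2 ^ n) * g n z \<le> ennreal k * G z"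
        using \<open>0 < k\<close> by (simp add: ennreal_mult mult.assoc)
    qed (use \<open>0 < q\<close> in simp)
    finally show "1 \<le> (\<integral>\<^sup>+z. ennpowr (ennreal k * G z) (1 / q) \<partial>l)" .
  qed
qed

theorem theorem5p5:
  fixes \<mu> :: "'a::metric_space measure"
    and \<E> :: "'a set set"
    and \<nu> :: "'a set \<Rightarrow> 'a measure"
    and p q C :: real
  assumes "1 < q" and "q < p"
    and "metric_measure_space \<mu>" and "doubling \<mu>"
    and "0 < C"
    and "\<forall>x. \<forall>r>0. emeasure \<mu> (ball x r) \<le> ennreal (C * r powr p)"
    and "\<forall>E\<in>\<E>. 1 \<le> conformal_dim E dist"
    and "system_of_measures \<mu> \<E> \<nu>"
    and "0 < modulus q \<mu> (\<nu> ` \<E>)"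
    and "\<forall>s>1. \<exists>C\<^sub>1>0. \<exists>C\<^sub>2>0. \<forall>E\<in>\<E>. \<forall>x. \<forall>r>0.
           ennreal r < ediam dist (UNIV :: 'a set) \<longrightarrow> ball x (r / C\<^sub>2) \<inter> E \<noteq> {} \<longrightarrow>
           ennreal (C\<^sub>1 * r powr s) \<le> emeasure (\<nu> E) (ball x r \<inter> E)"
  shows "ennreal q \<le> conformal_dim (UNIV :: 'a set) dist"
  unfolding conformal_dim_def
proof (rule Inf_greatest)
  fix v
  assume "v \<in> {hausdorff_dim (range f) e | (f :: 'a \<Rightarrow> 'a) N e.
                 Metric_space N e \<and> quasisymmetric UNIV dist N e f}"
  then obtain f :: "'a \<Rightarrow> 'a" and N e where v: "v = hausdorff_dim (range f) e"
    and N: "Metric_space N e" and f: "quasisymmetric UNIV dist N e f"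
    by (elim CollectE exE conjE)
  have M: "Metric_space (UNIV :: 'a set) dist"
    by unfold_locales (auto simp: dist_commute dist_triangle)
  interpret N: Metric_space N e by fact
  define d where "d = (\<lambda>x y. e (f x) (f y))"
  have d: "Metric_space UNIV d"
    using quasisymmetric_inj[OF M N f] unfolding d_def
    by unfold_locales (auto simp: N.commute inj_eq image_subset_iff intro: N.triangle)
  \<comment> \<open>For the exponent \<open>s = p / q\<close>, the factor \<open>r powr (s * q)\<close> and the growth bound \<open>r powr p\<close>
    cancel exactly.\<close>
  have "1 < p / q"
    using assms(1,2) by simp
  then obtain C\<^sub>1 C\<^sub>2 where C\<^sub>1\<^sub>2: "0 < C\<^sub>1" "0 < C\<^sub>2"
    and mass: "\<And>E x r. E \<in> \<E> \<Longrightarrow> 0 < r \<Longrightarrow> ennreal r < ediam dist (UNIV :: 'a set) \<Longrightarrow>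
      ball x (r / C\<^sub>2) \<inter> E \<noteq> {} \<Longrightarrow> ennreal (C\<^sub>1 * r powr (p / q)) \<le> emeasure (\<nu> E) (ball x r \<inter> E)"
    using assms(10) by meson
  obtain A where A: "1 \<le> A"
    "\<And>x v y. x \<noteq> v \<Longrightarrow> dist y x \<le> 2 * C\<^sub>2 * dist x v \<Longrightarrow> d y x \<le> A * d x v"
    using quasisymmetric_bound[OF N f, of "2 * C\<^sub>2"] C\<^sub>1\<^sub>2 unfolding d_def by auto
  have dim_E: "1 \<le> hausdorff_dim E d" if "E \<in> \<E>" for E
  proof -
    have "1 \<le> conformal_dim E dist"
      using assms(7) that by blast
    also have "\<dots> \<le> hausdorff_dim (f ` E) e"
      by (rule conformal_dim_le[OF _ N quasisymmetric_subset[OF M N f]])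
        (auto intro: Metric_space.subspace[OF M])
    also have "\<dots> \<le> hausdorff_dim E d"
      unfolding d_def by (rule hausdorff_dim_image_le)
    finally show ?thesis .
  qed
  have mass_ball: "ennreal (C\<^sub>1 * r powr (p / q)) \<le> emeasure (\<nu> E) (ball x r)"
    if "E \<in> \<E>" "0 < r" "ennreal r < ediam dist (UNIV :: 'a set)" "ball x (r / C\<^sub>2) \<inter> E \<noteq> {}" for E x r
  proof -
    have "ball x r \<in> sets (\<nu> E)"
      using assms(3,8) \<open>E \<in> \<E>\<close> borel_open[OF open_ball]
      unfolding metric_measure_space_def system_of_measures_def by blast
    then have "emeasure (\<nu> E) (ball x r \<inter> E) \<le> emeasure (\<nu> E) (ball x r)"
      by (intro emeasure_mono) auto
    then show ?thesis
      using mass[OF that] by (rule order_trans[rotated])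
  qed
  show "ennreal q \<le> v"
  proof (rule ccontr)
    assume "\<not> ?thesis"
    then have dim: "hausdorff_dim UNIV d < ennreal q"
      using hausdorff_dim_pullback_le[of UNIV e f] unfolding d_def v by simp
    have "modulus q \<mu> (\<nu> ` \<E>) = 0"
      by (rule modulus_eq_0_of_small_dimension[where C = C and p = p,
            OF _ _ assms(3) _ assms(8) C\<^sub>1\<^sub>2 mass_ball d _ A(2) dim_E dim])
        (use assms(1,5,6) A(1) in auto)
    with assms(9) show False by simp
  qed
qed

end
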